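(* In terms of the standard representation $\mathcal{S}$ of $\mathcal{L}_L$ the following holds. Given $n,m\ge 0$, $Z_{n,m}$ is a matrix in which the only non-zero entries are all equal to $1$ and are located on the $(n-m)$-th lower diagonal if $n>m$, or on the $(m-n)$-th upper diagonal if $m>n$. More precisely, given $n>m\ge 0$ and $k>0$: (a) $Z_{n-m,0}$ is a matrix in which all the entries of the $(n-m)$-th lower diagonal are equal to $1$; (b) $Z_{n-m+k,k}$ is a matrix having zeros as the first $k$ entries of the $(n-m)$-th lower diagonal, and all the other entries of that diagonal equal to $1$. Statements (a) and (b) also hold for the matrices $Z_{0,n-m}$ and $Z_{k,n-m+k}$, respectively, with "lower" replaced by "upper".
   Context: $\mathcal{L}_L$ is the complex Lie algebra with basis $\{Z_{n,m}: n,m\in\mathbb{Z},\ n,m\ge 0\}$ and bracket $$[Z_{n,m},Z_{l,s}]=\Theta(l-m)Z_{l-m+n,\,s}-\Theta(s-n)Z_{l,\,s-n+m}-\Theta(n-s)Z_{n-s+l,\,m}+\Theta(m-l)Z_{n,\,m-l+s}-\delta_{m,l}Z_{n,s}+\delta_{n,s}Z_{l,m},$$ where $\Theta(x)=1$ if $x\ge 0$ and $\Theta(x)=0$ if $x<0$, $\delta$ is the Kronecker delta, and terms with vanishing coefficient are read as $0$. The standard representation is $\mathcal{S}=\bigoplus_{k\ge 0}\mathbb{C}t_k$ with action $Z_{n,m}t_k=0$ if $m>k$ and $Z_{n,m}t_k=t_{k-m+n}$ if $m\le k$. Operators on $\mathcal{S}$ are written as infinite matrices $(a_{ij})_{i,j\ge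 0}$ in the basis $t_0,t_1,t_2,\dots$, with $A t_j=\sum_i a_{ij}t_i$. For $p>0$ the $p$-th lower diagonal consists of the entries $a_{j+p,j}$, $j=0,1,2,\dots$ (in this order), and the $p$-th upper diagonal of the entries $a_{j,j+p}$, $j=0,1,2,\dots$. *)

theory Defs
  imports Complex_Main "HOL-Library.Poly_Mapping"
begin

text \<open>The complex vector space with basis indexed by \<open>'i\<close> is the type of finitely
  supported functions \<open>'i \<Rightarrow>\<^sub>0 complex\<close>.\<close>

definition scl :: "complex \<Rightarrow> ('i \<Rightarrow>\<^sub>0 complex) \<Rightarrow> ('i \<Rightarrow>\<^sub>0 complex)"
  where "scl c x = Poly_Mapping.map ((*) c) x"

definition basis_vec :: "'i \<Rightarrow> ('i \<Rightarrow>\<^sub>0 complex)"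
  where "basis_vec i = Poly_Mapping.single i 1"

definition linear_ext ::
    "('i \<Rightarrow> ('k \<Rightarrow>\<^sub>0 complex)) \<Rightarrow> ('i \<Rightarrow>\<^sub>0 complex) \<Rightarrow> ('k \<Rightarrow>\<^sub>0 complex)"
  where "linear_ext f x =
    (\<Sum>i\<in>Poly_Mapping.keys x. scl (Poly_Mapping.lookup x i) (f i))"

definition bilinear_ext ::
    "('i \<Rightarrow> 'j \<Rightarrow> ('k \<Rightarrow>\<^sub>0 complex))
      \<Rightarrow> ('i \<Rightarrow>\<^sub>0 complex) \<Rightarrow> ('j \<Rightarrow>\<^sub>0 complex) \<Rightarrow> ('k \<Rightarrow>\<^sub>0 complex)"
  where "bilinear_ext f x y = linear_ext (\<lambda>i. linear_ext (f i) y) x"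

locale complex_lie_algebra = vector_space scale
  for scale :: "complex \<Rightarrow> 'a::ab_group_add \<Rightarrow> 'a" +
  fixes bracket :: "'a \<Rightarrow> 'a \<Rightarrow> 'a"
  assumes bracket_linear_left: "Vector_Spaces.linear scale scale (\<lambda>x. bracket x y)"
    and bracket_linear_right: "Vector_Spaces.linear scale scale (\<lambda>y. bracket x y)"
    and bracket_self: "bracket x x = 0"
    and jacobi: "bracket x (bracket y z) + bracket y (bracket z x) + bracket z (bracket x y) = 0"

locale complex_lie_representation =
  complex_lie_algebra scale bracket + V: vector_space vscale
  for scale :: "complex \<Rightarrow> 'a::ab_group_add \<Rightarrow> 'a"
    and bracket :: "'a \<Rightarrow> 'a \<Rightarrow> 'a"
    and vscale :: "complex \<Rightarrow> 'v::ab_group_add \<Rightarrow> 'v" +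
  fixes act :: "'a \<Rightarrow> 'v \<Rightarrow> 'v"
  assumes act_linear_left: "Vector_Spaces.linear scale vscale (\<lambda>x. act x v)"
    and act_linear_right: "Vector_Spaces.linear vscale vscale (act x)"
    and act_bracket: "act (bracket x y) v = act x (act y v) - act y (act x v)"

subsection \<open>The Lie algebra and its standard representation\<close>

type_synonym LL = "(nat \<times> nat) \<Rightarrow>\<^sub>0 complex"
type_synonym SS = "nat \<Rightarrow>\<^sub>0 complex"

definition Z :: "nat \<Rightarrow> nat \<Rightarrow> LL"
  where "Z n m = basis_vec (n, m)"

definition t :: "nat \<Rightarrow> SS"
  where "t k = basis_vec k"

definition Theta :: "int \<Rightarrow> complex"
  where "Theta x = (if x \<ge> 0 then 1 else 0)"

definition kdelta :: "nat \<Rightarrow> nat \<Rightarrow> complex"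
  where "kdelta m l = (if m = l then 1 else 0)"

text \<open>The arguments of \<^const>\<open>Theta\<close> are integer differences; the index differences are
  truncated differences of naturals, which agree with the integer ones whenever the
  coefficient of the term is nonzero.\<close>

definition LL_bracket_basis :: "nat \<times> nat \<Rightarrow> nat \<times> nat \<Rightarrow> LL"
  where "LL_bracket_basis = (\<lambda>(n, m) (l, s).
      scl (Theta (int l - int m)) (Z (l - m + n) s)
    - scl (Theta (int s - int n)) (Z l (s - n + m))
    - scl (Theta (int n - int s)) (Z (n - s + l) m)
    + scl (Theta (int m - int l)) (Z n (m - l + s))
    - scl (kdelta m l) (Z n s)
    + scl (kdelta n s) (Z l m))"

definition LL_bracket :: "LL \<Rightarrow> LL \<Rightarrow> LL"
  where "LL_bracket = bilinear_ext LL_bracket_basis"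

definition std_act_basis :: "nat \<times> nat \<Rightarrow> nat \<Rightarrow> SS"
  where "std_act_basis = (\<lambda>(n, m) k. if m > k then 0 else t (k - m + n))"

definition std_rep :: "LL \<Rightarrow> SS \<Rightarrow> SS"
  where "std_rep = bilinear_ext std_act_basis"

subsection \<open>Infinite matrices\<close>

definition matrix_of :: "(SS \<Rightarrow> SS) \<Rightarrow> nat \<Rightarrow> nat \<Rightarrow> complex"
  where "matrix_of A i j = Poly_Mapping.lookup (A (t j)) i"

definition lower_diagonal :: "nat \<Rightarrow> (nat \<Rightarrow> nat \<Rightarrow> complex) \<Rightarrow> nat \<Rightarrow> complex"
  where "lower_diagonal p a j = a (j + p) j"

definition upper_diagonal :: "nat \<Rightarrow> (nat \<Rightarrow> nat \<Rightarrow> complex) \<Rightarrow> nat \<Rightarrow> complex"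
  where "upper_diagonal p a j = a j (j + p)"

definition on_lower_diagonal :: "nat \<Rightarrow> nat \<Rightarrow> nat \<Rightarrow> bool"
  where "on_lower_diagonal p r c \<longleftrightarrow> (\<exists>j. r = j + p \<and> c = j)"

definition on_upper_diagonal :: "nat \<Rightarrow> nat \<Rightarrow> nat \<Rightarrow> bool"
  where "on_upper_diagonal p r c \<longleftrightarrow> (\<exists>j. r = j \<and> c = j + p)"

subsection \<open>The definitions above describe a Lie algebra and a representation\<close>

lemma lookup_scl [simp]: "Poly_Mapping.lookup (scl c x) i = c * Poly_Mapping.lookup x i"
  unfolding scl_def by (simp add: Poly_Mapping.map.rep_eq when_def)

lemma vector_space_scl: "vector_space scl"
  by unfold_locales
    (auto intro!: poly_mapping_eqI simp: lookup_add algebra_simps)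

interpretation F: vector_space scl by (rule vector_space_scl)
interpretation FP: vector_space_pair scl scl ..

lemma linear_sclI:
  assumes "\<And>x y. f (x + y) = f x + f y" "\<And>c x. f (scl c x) = scl c (f x)"
  shows "Vector_Spaces.linear scl scl f"
  by unfold_locales (use assms in auto)

lemma linear_ext_superset:
  assumes "finite K" "Poly_Mapping.keys x \<subseteq> K"
  shows "linear_ext f x = (\<Sum>i\<in>K. scl (Poly_Mapping.lookup x i) (f i))"
  unfolding linear_ext_def
  by (rule sum.mono_neutral_left) (use assms in \<open>auto simp: in_keys_iff\<close>)

lemma linear_linear_ext: "Vector_Spaces.linear scl scl (linear_ext f)"
proof (rule linear_sclI)
  fix x y :: "'a \<Rightarrow>\<^sub>0 complex"
  let ?K = "Poly_Mapping.keys x \<union> Poly_Mapping.keys y"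
  have "Poly_Mapping.keys (x + y) \<subseteq> ?K" by (rule Poly_Mapping.keys_add)
  then show "linear_ext f (x + y) = linear_ext f x + linear_ext f y"
    by (simp add: linear_ext_superset[of ?K] lookup_add F.scale_left_distrib sum.distrib)
next
  fix c and x :: "'a \<Rightarrow>\<^sub>0 complex"
  have "Poly_Mapping.keys (scl c x) \<subseteq> Poly_Mapping.keys x" by (auto simp: in_keys_iff)
  then show "linear_ext f (scl c x) = scl c (linear_ext f x)"
    by (simp add: linear_ext_superset[of "Poly_Mapping.keys x"] F.scale_sum_right)
qed

lemma linear_ext_basis [simp]: "linear_ext f (basis_vec i) = f i"
  by (simp add: linear_ext_def basis_vec_def)

lemma basis_expansion: "x = linear_ext basis_vec x"
proof (rule poly_mapping_eqI)
  fix k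
  show "Poly_Mapping.lookup x k = Poly_Mapping.lookup (linear_ext basis_vec x) k"
    by (auto simp: linear_ext_def basis_vec_def lookup_sum lookup_single when_def in_keys_iff
        if_distrib cong: if_cong)
qed

lemma linear_eq_on_basis:
  fixes f g :: "('i \<Rightarrow>\<^sub>0 complex) \<Rightarrow> ('k \<Rightarrow>\<^sub>0 complex)"
  assumes f: "Vector_Spaces.linear scl scl f" and g: "Vector_Spaces.linear scl scl g"
    and eq: "\<And>i. f (basis_vec i) = g (basis_vec i)"
  shows "f x = g x"
proof -
  interpret f: Vector_Spaces.linear scl scl f by (rule f)
  interpret g: Vector_Spaces.linear scl scl g by (rule g)
  have "f (linear_ext basis_vec x) = g (linear_ext basis_vec x)"
    by (simp add: linear_ext_def f.sum f.scale g.sum g.scale eq)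
  then show ?thesis by (simp flip: basis_expansion)
qed

lemma linear_bilinear_ext_left: "Vector_Spaces.linear scl scl (\<lambda>x. bilinear_ext f x y)"
  unfolding bilinear_ext_def by (rule linear_linear_ext)

lemma linear_bilinear_ext_right: "Vector_Spaces.linear scl scl (\<lambda>y. bilinear_ext f x y)"
  by (rule linear_sclI)
    (simp_all add: bilinear_ext_def linear_ext_def[of _ x] F.scale_right_distrib sum.distrib
      F.scale_sum_right mult.commute FP.linear_add[OF linear_linear_ext]
      FP.linear_scale[OF linear_linear_ext])

lemma bilinear_ext_basis [simp]: "bilinear_ext f (basis_vec i) (basis_vec j) = f i j"
  by (simp add: bilinear_ext_def)

lemma LL_bracket_Z:
  "LL_bracket (Z n m) (Z l s) =
      scl (Theta (int l - int m)) (Z (l - m + n) s)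
    - scl (Theta (int s - int n)) (Z l (s - n + m))
    - scl (Theta (int n - int s)) (Z (n - s + l) m)
    + scl (Theta (int m - int l)) (Z n (m - l + s))
    - scl (kdelta m l) (Z n s)
    + scl (kdelta n s) (Z l m)"
  by (simp add: LL_bracket_def Z_def LL_bracket_basis_def)

lemma std_rep_Z_t: "std_rep (Z n m) (t k) = (if m > k then 0 else t (k - m + n))"
  by (simp add: std_rep_def Z_def t_def std_act_basis_def)

lemma bilinear_ext_linear_simps [simp]:
  "bilinear_ext f (x + x') y = bilinear_ext f x y + bilinear_ext f x' y"
  "bilinear_ext f (x - x') y = bilinear_ext f x y - bilinear_ext f x' y"
  "bilinear_ext f (scl c x) y = scl c (bilinear_ext f x y)"
  "bilinear_ext f 0 y = 0"
  "bilinear_ext f x (z + z') = bilinear_ext f x z + bilinear_ext f x z'"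
  "bilinear_ext f x (z - z') = bilinear_ext f x z - bilinear_ext f x z'"
  "bilinear_ext f x (scl c z) = scl c (bilinear_ext f x z)"
  "bilinear_ext f x 0 = 0"
  by (rule FP.linear_add[OF linear_bilinear_ext_left] FP.linear_diff[OF linear_bilinear_ext_left]
    FP.linear_scale[OF linear_bilinear_ext_left] FP.linear_0[OF linear_bilinear_ext_left]
    FP.linear_add[OF linear_bilinear_ext_right] FP.linear_diff[OF linear_bilinear_ext_right]
    FP.linear_scale[OF linear_bilinear_ext_right] FP.linear_0[OF linear_bilinear_ext_right])+

text \<open>The bracket is the commutator of an associative product, which is used to derive the
  Jacobi identity.\<close>

definition LL_mult_basis :: "nat \<times> nat \<Rightarrow> nat \<times> nat \<Rightarrow> LL"
  where "LL_mult_basis = (\<lambda>(n, m) (l, s). if m \<le> l then Z (l - m + n) s else Z n (m - l + s))"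

definition LL_mult :: "LL \<Rightarrow> LL \<Rightarrow> LL"
  where "LL_mult = bilinear_ext LL_mult_basis"

lemma LL_mult_linear_simps [simp]:
  "LL_mult (x + x') y = LL_mult x y + LL_mult x' y"
  "LL_mult (x - x') y = LL_mult x y - LL_mult x' y"
  "LL_mult (scl c x) y = scl c (LL_mult x y)"
  "LL_mult x (z + z') = LL_mult x z + LL_mult x z'"
  "LL_mult x (z - z') = LL_mult x z - LL_mult x z'"
  "LL_mult x (scl c z) = scl c (LL_mult x z)"
  by (simp_all add: LL_mult_def)

lemma std_rep_linear_simps [simp]:
  "std_rep (x + x') v = std_rep x v + std_rep x' v"
  "std_rep (x - x') v = std_rep x v - std_rep x' v"
  "std_rep (scl c x) v = scl c (std_rep x v)"
  "std_rep x (v + v') = std_rep x v + std_rep x v'"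
  "std_rep x (v - v') = std_rep x v - std_rep x v'"
  "std_rep x (scl c v) = scl c (std_rep x v)"
  "std_rep x 0 = 0"
  by (simp_all add: std_rep_def)

lemma LL_bracket_eq_commutator: "LL_bracket x y = LL_mult x y - LL_mult y x"
proof (rule linear_eq_on_basis[where f = "\<lambda>x. LL_bracket x y" and g = "\<lambda>x. LL_mult x y - LL_mult y x"])
  fix a :: "nat \<times> nat"
  show "LL_bracket (basis_vec a) y = LL_mult (basis_vec a) y - LL_mult y (basis_vec a)"
  proof (rule linear_eq_on_basis[where g = "\<lambda>y. LL_mult (basis_vec a) y - LL_mult y (basis_vec a)"])
    fix b :: "nat \<times> nat"
    obtain n m l s where ab: "a = (n, m)" "b = (l, s)" by (cases a, cases b)
    show "LL_bracket (basis_vec a) (basis_vec b)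
        = LL_mult (basis_vec a) (basis_vec b) - LL_mult (basis_vec b) (basis_vec a)"
      by (auto simp: LL_bracket_def LL_mult_def LL_bracket_basis_def LL_mult_basis_def ab
          Theta_def kdelta_def add.commute)
  qed (auto intro!: linear_sclI simp: LL_bracket_def algebra_simps F.scale_right_diff_distrib)
qed (auto intro!: linear_sclI simp: LL_bracket_def algebra_simps F.scale_right_diff_distrib)

lemma LL_mult_assoc_Z:
  "LL_mult (LL_mult (Z a b) (Z c d)) (Z e f) = LL_mult (Z a b) (LL_mult (Z c d) (Z e f))"
proof -
  have *: "LL_mult (Z n m) (Z l s) = (if m \<le> l then Z (l - m + n) s else Z n (m - l + s))"
    for n m l s by (simp add: LL_mult_def Z_def LL_mult_basis_def)
  have **: "n = n' \<Longrightarrow> m = m' \<Longrightarrow> Z n m = Z n' m'" for n m n' m' by simp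
  show ?thesis by (auto simp: * intro!: **)
qed

lemma LL_mult_assoc: "LL_mult (LL_mult x y) z = LL_mult x (LL_mult y z)"
proof (rule linear_eq_on_basis[where f = "\<lambda>x. LL_mult (LL_mult x y) z"])
  fix a :: "nat \<times> nat"
  let ?a = "basis_vec a"
  show "LL_mult (LL_mult ?a y) z = LL_mult ?a (LL_mult y z)"
  proof (rule linear_eq_on_basis[where f = "\<lambda>y. LL_mult (LL_mult ?a y) z"])
    fix b :: "nat \<times> nat"
    let ?b = "basis_vec b"
    show "LL_mult (LL_mult ?a ?b) z = LL_mult ?a (LL_mult ?b z)"
    proof (rule linear_eq_on_basis[where f = "LL_mult (LL_mult ?a ?b)"])
      fix c :: "nat \<times> nat"
      show "LL_mult (LL_mult ?a ?b) (basis_vec c) = LL_mult ?a (LL_mult ?b (basis_vec c))"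
        using LL_mult_assoc_Z unfolding Z_def by (cases a, cases b, cases c) simp
    qed (auto intro!: linear_sclI)
  qed (auto intro!: linear_sclI)
qed (auto intro!: linear_sclI)

lemma std_rep_mult: "std_rep (LL_mult x y) v = std_rep x (std_rep y v)"
proof (rule linear_eq_on_basis[where f = "\<lambda>x. std_rep (LL_mult x y) v"])
  fix a :: "nat \<times> nat"
  let ?a = "basis_vec a"
  show "std_rep (LL_mult ?a y) v = std_rep ?a (std_rep y v)"
  proof (rule linear_eq_on_basis[where f = "\<lambda>y. std_rep (LL_mult ?a y) v"])
    fix b :: "nat \<times> nat"
    let ?b = "basis_vec b"
    show "std_rep (LL_mult ?a ?b) v = std_rep ?a (std_rep ?b v)"
    proof (rule linear_eq_on_basis[where f = "std_rep (LL_mult ?a ?b)"])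
      fix k :: nat
      obtain n m l s where ab: "a = (n, m)" "b = (l, s)" by (cases a, cases b)
      have *: "LL_mult (Z n m) (Z l s) = (if m \<le> l then Z (l - m + n) s else Z n (m - l + s))"
        by (simp add: LL_mult_def Z_def LL_mult_basis_def)
      have **: "i = j \<Longrightarrow> t i = t j" for i j by simp
      have "std_rep (LL_mult (Z n m) (Z l s)) (t k) = std_rep (Z n m) (std_rep (Z l s) (t k))"
        by (auto simp: * std_rep_Z_t intro!: **)
      then show "std_rep (LL_mult ?a ?b) (basis_vec k) = std_rep ?a (std_rep ?b (basis_vec k))"
        by (simp add: ab Z_def t_def)
    qed (auto intro!: linear_sclI)
  qed (auto intro!: linear_sclI)
qed (auto intro!: linear_sclI)

lemma complex_lie_algebra_LL: "complex_lie_algebra scl LL_bracket"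
proof (intro complex_lie_algebra.intro complex_lie_algebra_axioms.intro)
  show "LL_bracket x x = 0" for x by (simp add: LL_bracket_eq_commutator)
  show "LL_bracket x (LL_bracket y z) + LL_bracket y (LL_bracket z x)
      + LL_bracket z (LL_bracket x y) = 0" for x y z
    by (simp add: LL_bracket_eq_commutator LL_mult_assoc algebra_simps)
qed (auto simp: LL_bracket_def intro: vector_space_scl linear_bilinear_ext_left
    linear_bilinear_ext_right)

lemma complex_lie_representation_std:
  "complex_lie_representation scl LL_bracket scl std_rep"
proof (intro complex_lie_representation.intro complex_lie_representation_axioms.intro)
  show "std_rep (LL_bracket x y) v = std_rep x (std_rep y v) - std_rep y (std_rep x v)" for x y v
    by (simp add: LL_bracket_eq_commutator std_rep_mult)
qed (auto simp: std_rep_def intro: vector_space_scl complex_lie_algebra_LL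
    linear_bilinear_ext_left linear_bilinear_ext_right)

lemma matrix_of_column:
  "A (t j) = (\<Sum>i\<in>Poly_Mapping.keys (A (t j)). scl (matrix_of A i j) (t i))"
  using basis_expansion[of "A (t j)"] by (simp add: linear_ext_def matrix_of_def t_def)

end

theory Submission
  imports Defs
begin

text \<open>Column \<open>j\<close> of \<open>Z n m\<close> is zero for \<open>j < m\<close> and
  otherwise has a single 1, in the row with i - j = n - m. So n - m selects the diagonal, and
  \<open>m \<le> j\<close> decides where its ones begin.\<close>

text \<open>The row condition is stated additively to avoid truncated subtraction.\<close>

lemma matrix_of_std_rep_Z:
  "matrix_of (std_rep (Z n m)) i j = (if m \<le> j \<and> i + m = j + n then 1 else 0)"
  \<comment> \<open>\<open>t\<close> stays folded until \<open>std_rep_Z_t\<close> has rewritten the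
    action.\<close>
  by (auto simp: matrix_of_def std_rep_Z_t) (auto simp: t_def basis_vec_def lookup_single when_def)

theorem proposition2p8:
  shows
    "(\<forall>n m. \<forall>i j. matrix_of (std_rep (Z n m)) i j \<noteq> 0 \<longrightarrow>
         matrix_of (std_rep (Z n m)) i j = 1
         \<and> (n > m \<longrightarrow> on_lower_diagonal (n - m) i j)
         \<and> (m > n \<longrightarrow> on_upper_diagonal (m - n) i j))
     \<and>
     (\<forall>n m k. n > m \<and> k > 0 \<longrightarrow>
         (\<forall>j. lower_diagonal (n - m) (matrix_of (std_rep (Z (n - m) 0))) j = 1)
         \<and> (\<forall>j<k. lower_diagonal (n - m) (matrix_of (std_rep (Z (n - m + k) k))) j = 0)
         \<and> (\<forall>j\<ge>k. lower_diagonal (n - m) (matrix_of (std_rep (Z (n - m + k) k))) j = 1)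
         \<and> (\<forall>j. upper_diagonal (n - m) (matrix_of (std_rep (Z 0 (n - m)))) j = 1)
         \<and> (\<forall>j<k. upper_diagonal (n - m) (matrix_of (std_rep (Z k (n - m + k)))) j = 0)
         \<and> (\<forall>j\<ge>k. upper_diagonal (n - m) (matrix_of (std_rep (Z k (n - m + k)))) j = 1))"
  \<comment> \<open>On the upper diagonal position \<open>j\<close> lies in column
    \<open>j + (n - m)\<close>, so \<open>n - m + k \<le> j + (n - m)\<close> again means
    \<open>k \<le> j\<close>.\<close>
  by (auto simp: matrix_of_std_rep_Z lower_diagonal_def upper_diagonal_def
      on_lower_diagonal_def on_upper_diagonal_def split: if_splits)

end
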